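(* Let $X$ be a graph as in the context, let $M\in\{A,L,Q\}$, and let $\{u,v\}$ be a pair of twin vertices of $X$ with associated eigenvalue $\theta$. Write $\sigma_u(M)=\{\theta,\lambda_1,\ldots,\lambda_r\}$ (distinct elements). Suppose that for some real numbers $\tau,\zeta,\gamma$, proper $(e^{i\zeta}\cos\gamma,\ ie^{i\zeta}\sin\gamma)$-fractional revival occurs between $u$ and $v$ at time $\tau$. Then: (1) $u$ and $v$ are strongly cospectral with $\sigma_{uv}^+(M)=\{\lambda_1,\ldots,\lambda_r\}$ and $\sigma_{uv}^-(M)=\{\theta\}$; and (2) for all $j,k\in\{1,\ldots,r\}$, $\tau(\lambda_j-\lambda_k)\equiv 0 \pmod{2\pi}$ and $\tau(\lambda_j-\theta)\equiv 2\gamma \pmod{2\pi}$. Conversely, if $u,v$ and $\sigma_u(M)=\{\theta,\lambda_1,\ldots,\lambda_r\}$ satisfy (1) and real numbers $\tau,\gamma$ satisfy (2), then there is a real $\zeta$ such that $(e^{i\zeta}\cos\gamma,\ ie^{i\zeta}\sin\gamma)$-fractional revival occurs between $u$ and $v$ at time $\tau$, and this fractional revival is proper if and only if $\gamma$ is not an integer multiple of $\pi$.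
   Context: $X$ is a connected weighted undirected graph, possibly with loops but without multiple edges, whose edges have nonzero real weights; $\omega_{a,b}$ denotes the weight of the edge $(a,b)$ (and $0$ if there is no edge). $A$ is the adjacency matrix ($A_{a,b}=\omega_{a,b}$), $D$ is the diagonal degree matrix with $\deg(a)=2\omega_{a,a}+\sum_{b\neq a}\omega_{a,b}$, $L=D-A$ and $Q=D+A$. For $M\in\{A,L,Q\}$ put $U(t)=e^{itM}$, and let $M=\sum_j\lambda_jE_j$ be the spectral decomposition ($\lambda_j$ distinct eigenvalues, $E_j$ orthogonal projections onto eigenspaces). $\mathbf e_a$ is the standard basis vector of vertex $a$. The eigenvalue support of $a$ is $\sigma_a(M)=\{\lambda_j: E_j\mathbf e_a\neq 0\}$. Distinct vertices $u,v$ are twins if $N(u)\setminus\{u,v\}=N(v)\setminus\{u,v\}$, $\omega_{u,w}=\omega_{v,w}$ for every such neighbour $w$, and $\omega_{u,u}=\omega_{v,v}$. For twins $u,v$ set $\omega=\omega_{u,u}$, $\eta=\omega_{u,v}$ and $\theta=\omega-\eta$ if $M=A$, $\theta=\deg(u)-\omega+\eta$ if $M=L$, $\theta=\deg(u)+\omega-\eta$ if $M=Q$; then $\mathbf e_u-\mathbf e_v$ is an eigenvector of $M$ with eigenvalue $\theta$. Vertices $u,v$ are strongly cospectral if $E_j\mathbf e_u=\pm E_j\mathbf e_v$ for every $j$; then $\sigma_{uv}^+(M)=\{\lambda_j:E_j\mathbf e_u=E_j\mathbf e_v\neq 0\}$ and $\sigma_{uv}^-(M)=\{\lambda_j:E_j\mathbf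 e_u=-E_j\mathbf e_v\neq0\}$. For $\alpha,\beta\in\mathbb C$, $(\alpha,\beta)$-fractional revival (FR) occurs from $u$ to $v$ at time $\tau$ if $U(\tau)\mathbf e_u=\alpha\mathbf e_u+\beta\mathbf e_v$ (so $|\alpha|^2+|\beta|^2=1$); it is proper if $\beta\neq0$. "Between $u$ and $v$" means from $u$ to $v$. *)

theory Defs
  imports "HOL-Analysis.Analysis" "HOL-Library.Real_Mod"
begin

text \<open>
  A weighted graph on the finite vertex type \<^typ>\<open>'n\<close> is given by its weight matrix
  \<^term>\<open>W\<close>: the edge between \<^term>\<open>a\<close> and \<^term>\<open>b\<close> exists iff its weight
  \<^term>\<open>W $ a $ b\<close> is nonzero. Loops are the nonzero diagonal entries.
\<close>

type_synonym 'n wgraph = "real^'n^'n"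

definition undirected :: "'n::finite wgraph \<Rightarrow> bool" where
  "undirected W \<longleftrightarrow> (\<forall>a b. W $ a $ b = W $ b $ a)"

definition edges :: "'n::finite wgraph \<Rightarrow> ('n \<times> 'n) set" where
  "edges W = {(a, b). W $ a $ b \<noteq> 0}"

definition neighbours :: "'n::finite wgraph \<Rightarrow> 'n \<Rightarrow> 'n set" where
  "neighbours W a = {b. (a, b) \<in> edges W}"

definition connected_graph :: "'n::finite wgraph \<Rightarrow> bool" where
  "connected_graph W \<longleftrightarrow> (\<forall>a b. (a, b) \<in> (edges W)\<^sup>*)"

definition deg :: "'n::finite wgraph \<Rightarrow> 'n \<Rightarrow> real" where
  "deg W a = 2 * W $ a $ a + (\<Sum>b\<in>UNIV - {a}. W $ a $ b)"

definition degree_matrix :: "'n::finite wgraph \<Rightarrow> real^'n^'n" where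
  "degree_matrix W = (\<chi> a b. if a = b then deg W a else 0)"

datatype matrix_kind = Adjacency | Laplacian | Signless_Laplacian

fun graph_matrix :: "matrix_kind \<Rightarrow> 'n::finite wgraph \<Rightarrow> real^'n^'n" where
  "graph_matrix Adjacency W = W"
| "graph_matrix Laplacian W = degree_matrix W - W"
| "graph_matrix Signless_Laplacian W = degree_matrix W + W"

definition twins :: "'n::finite wgraph \<Rightarrow> 'n \<Rightarrow> 'n \<Rightarrow> bool" where
  "twins W u v \<longleftrightarrow>
     u \<noteq> v \<and>
     neighbours W u - {u, v} = neighbours W v - {u, v} \<and>
     (\<forall>w\<in>neighbours W u - {u, v}. W $ u $ w = W $ v $ w) \<and>
     W $ u $ u = W $ v $ v"

fun twin_eigenvalue :: "matrix_kind \<Rightarrow> 'n::finite wgraph \<Rightarrow> 'n \<Rightarrow> 'n \<Rightarrow> real" where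
  "twin_eigenvalue Adjacency W u v = W $ u $ u - W $ u $ v"
| "twin_eigenvalue Laplacian W u v = deg W u - W $ u $ u + W $ u $ v"
| "twin_eigenvalue Signless_Laplacian W u v = deg W u + W $ u $ u - W $ u $ v"

text \<open>
  The matrices in question are real symmetric, so their eigenvalues are real and the
  orthogonal projections onto their eigenspaces are real matrices.
\<close>

definition eigenspace :: "real^'n^'n \<Rightarrow> real \<Rightarrow> (real^'n::finite) set" where
  "eigenspace M \<mu> = {x. M *v x = \<mu> *\<^sub>R x}"

definition eigenvalues :: "real^'n^'n::finite \<Rightarrow> real set" where
  "eigenvalues M = {\<mu>. \<exists>x\<in>eigenspace M \<mu>. x \<noteq> 0}"

definition is_orth_projection :: "real^'n^'n::finite \<Rightarrow> (real^'n) set \<Rightarrow> bool" where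
  "is_orth_projection P S \<longleftrightarrow>
     (\<forall>x. P *v x \<in> S \<and> (\<forall>y\<in>S. orthogonal (x - P *v x) y))"

definition eigenprojection :: "real^'n^'n::finite \<Rightarrow> real \<Rightarrow> real^'n^'n" where
  "eigenprojection M \<mu> = (THE P. is_orth_projection P (eigenspace M \<mu>))"

lemma subspace_eigenspace: "subspace (eigenspace M \<mu>)"
  by (auto simp: eigenspace_def subspace_def matrix_vector_right_distrib
      scaleR_right_distrib matrix_vector_mult_scaleR)

lemma ex1_orth_projection:
  fixes S :: "(real^'n::finite) set"
  assumes S: "subspace S"
  shows "\<exists>!P. is_orth_projection P S"
proof -
  have uniq: "p = q"
    if "p \<in> S" "q \<in> S" "\<And>y. y \<in> S \<Longrightarrow> orthogonal (x - p) y"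
       "\<And>y. y \<in> S \<Longrightarrow> orthogonal (x - q) y" for p q x
  proof -
    have d: "p - q \<in> S" using S that by (simp add: subspace_diff)
    have "(p - q) \<bullet> (p - q) = (x - q) \<bullet> (p - q) - (x - p) \<bullet> (p - q)"
      by (simp add: inner_diff_left)
    also have "\<dots> = 0" using that(3,4)[OF d] by (simp add: orthogonal_def)
    finally show ?thesis by simp
  qed
  have "\<exists>p. p \<in> S \<and> (\<forall>y\<in>S. orthogonal (x - p) y)" for x
  proof -
    obtain p z where "p \<in> span S" "\<And>w. w \<in> span S \<Longrightarrow> orthogonal z w" "x = p + z"
      using orthogonal_subspace_decomp_exists[of S x] by metis
    then show ?thesis using S by (auto simp: span_eq_iff[THEN iffD2])
  qed
  then obtain f where f: "\<And>x. f x \<in> S" "\<And>x y. y \<in> S \<Longrightarrow> orthogonal (x - f x) y"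
    by metis
  have "linear f"
  proof (rule linearI)
    fix x y :: "real^'n" and c :: real
    show "f (x + y) = f x + f y"
    proof (rule uniq[of _ _ "x + y"])
      fix z assume "z \<in> S"
      then show "orthogonal (x + y - (f x + f y)) z"
        using f(2)[of z x] f(2)[of z y]
        by (simp add: orthogonal_def inner_diff_left inner_add_left)
    qed (use f S in \<open>auto intro: subspace_add\<close>)
    show "f (c *\<^sub>R x) = c *\<^sub>R f x"
    proof (rule uniq[of _ _ "c *\<^sub>R x"])
      fix z assume "z \<in> S"
      then show "orthogonal (c *\<^sub>R x - c *\<^sub>R f x) z"
        using f(2)[of z x]
        by (simp add: orthogonal_def inner_diff_left)
    qed (use f S in \<open>auto intro: subspace_scale\<close>)
  qed
  then have mf: "matrix f *v x = f x" for x by (simp add: matrix_works)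
  show ?thesis
  proof (rule ex1I[of _ "matrix f"])
    show "is_orth_projection (matrix f) S"
      using f by (simp add: is_orth_projection_def mf)
    fix P assume P: "is_orth_projection P S"
    show "P = matrix f"
      unfolding matrix_eq mf
    proof
      fix x show "P *v x = f x"
        by (rule uniq[of _ _ x]) (use P f in \<open>auto simp: is_orth_projection_def\<close>)
    qed
  qed
qed

lemma eigenprojection: "is_orth_projection (eigenprojection M \<mu>) (eigenspace M \<mu>)"
  unfolding eigenprojection_def
  by (rule theI') (rule ex1_orth_projection[OF subspace_eigenspace])

definition eigenvalue_support :: "real^'n^'n::finite \<Rightarrow> 'n \<Rightarrow> real set" where
  "eigenvalue_support M a = {\<mu>\<in>eigenvalues M. eigenprojection M \<mu> *v axis a 1 \<noteq> 0}"

definition strongly_cospectral :: "real^'n^'n::finite \<Rightarrow> 'n \<Rightarrow> 'n \<Rightarrow> bool" where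
  "strongly_cospectral M u v \<longleftrightarrow>
     (\<forall>\<mu>\<in>eigenvalues M.
        eigenprojection M \<mu> *v axis u 1 = eigenprojection M \<mu> *v axis v 1 \<or>
        eigenprojection M \<mu> *v axis u 1 = - (eigenprojection M \<mu> *v axis v 1))"

definition support_plus :: "real^'n^'n::finite \<Rightarrow> 'n \<Rightarrow> 'n \<Rightarrow> real set" where
  "support_plus M u v =
     {\<mu>\<in>eigenvalues M. eigenprojection M \<mu> *v axis u 1 = eigenprojection M \<mu> *v axis v 1 \<and>
                       eigenprojection M \<mu> *v axis u 1 \<noteq> 0}"

definition support_minus :: "real^'n^'n::finite \<Rightarrow> 'n \<Rightarrow> 'n \<Rightarrow> real set" where
  "support_minus M u v =
     {\<mu>\<in>eigenvalues M. eigenprojection M \<mu> *v axis u 1 = - (eigenprojection M \<mu> *v axis v 1) \<and>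
                       eigenprojection M \<mu> *v axis u 1 \<noteq> 0}"

primrec matrix_pow :: "complex^'n^'n::finite \<Rightarrow> nat \<Rightarrow> complex^'n^'n" where
  "matrix_pow B 0 = mat 1"
| "matrix_pow B (Suc k) = B ** matrix_pow B k"

text \<open>
  Square matrices are not an instance of \<^class>\<open>real_normed_algebra_1\<close>, so \<^const>\<open>exp\<close> does
  not apply to them.
\<close>

definition matrix_exp :: "complex^'n^'n::finite \<Rightarrow> complex^'n^'n" where
  "matrix_exp B = (\<Sum>k. (1 / fact k) *\<^sub>R matrix_pow B k)"

definition transition_matrix :: "real^'n^'n::finite \<Rightarrow> real \<Rightarrow> complex^'n^'n" where
  "transition_matrix M t = matrix_exp (map_matrix (\<lambda>x. \<i> * of_real t * of_real x) M)"

definition fractional_revival ::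
  "real^'n^'n::finite \<Rightarrow> complex \<Rightarrow> complex \<Rightarrow> 'n \<Rightarrow> 'n \<Rightarrow> real \<Rightarrow> bool" where
  "fractional_revival M \<alpha> \<beta> u v \<tau> \<longleftrightarrow>
     transition_matrix M \<tau> *v axis u 1 = \<alpha> *s axis u 1 + \<beta> *s axis v 1"

definition proper_fractional_revival ::
  "real^'n^'n::finite \<Rightarrow> complex \<Rightarrow> complex \<Rightarrow> 'n \<Rightarrow> 'n \<Rightarrow> real \<Rightarrow> bool" where
  "proper_fractional_revival M \<alpha> \<beta> u v \<tau> \<longleftrightarrow> fractional_revival M \<alpha> \<beta> u v \<tau> \<and> \<beta> \<noteq> 0"

end

theory Submission
  imports Defs
begin

text \<open>
  Fractional revival from \<open>u\<close> to \<open>v\<close> can be tested against eigenvectors: by the spectral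
  theorem it occurs iff every eigenvector \<open>y\<close> of \<open>M\<close>, for an eigenvalue \<open>\<mu>\<close>, satisfies
  \<open>exp (\<i> \<tau> \<mu>) y\<^sub>u = \<alpha> y\<^sub>u + \<beta> y\<^sub>v\<close>. For twins, \<open>e\<^sub>u - e\<^sub>v\<close> is an eigenvector for \<open>\<theta>\<close>, so this
  test yields \<open>exp (\<i> \<tau> \<theta>) = \<alpha> - \<beta>\<close>, and \<open>\<beta> \<noteq> 0\<close> then forces \<open>y\<^sub>u = - y\<^sub>v\<close> on the whole eigenspace
  of \<open>\<theta>\<close>. Eigenvectors for \<open>\<mu> \<noteq> \<theta>\<close> are orthogonal to \<open>e\<^sub>u - e\<^sub>v\<close>, so there \<open>y\<^sub>u = y\<^sub>v\<close> and the test
  reads \<open>exp (\<i> \<tau> \<mu>) = \<alpha> + \<beta>\<close> on the support of \<open>u\<close>.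
\<close>

section \<open>Spectral theorem for real symmetric matrices\<close>

lemma matrix_vector_mult_axis_nth:
  fixes A :: "'a::semiring_1^'n^'m"
  shows "(A *v axis j 1) $ i = A $ i $ j"
  by (simp add: matrix_vector_mult_def axis_def if_distrib[of "(*) _"] cong: if_cong)

lemma inner_symmetric_matrix:
  fixes M :: "real^'n^'n::finite"
  assumes "transpose M = M"
  shows "(M *v x) \<bullet> y = x \<bullet> (M *v y)"
  using dot_lmul_matrix[of x M y] assms vector_transpose_matrix[of x M] by simp

lemma eigenspaces_orthogonal:
  fixes M :: "real^'n^'n::finite"
  assumes "transpose M = M" "x \<in> eigenspace M \<mu>" "y \<in> eigenspace M \<nu>" "\<mu> \<noteq> \<nu>"
  shows "x \<bullet> y = 0"
  using inner_symmetric_matrix[OF assms(1), of x y] assms(2-4) by (simp add: eigenspace_def)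

text \<open>A maximiser of the Rayleigh quotient on the unit sphere of the subspace is an eigenvector.\<close>

lemma invariant_subspace_contains_eigenvector:
  fixes M :: "real^'n^'n::finite"
  assumes sym: "transpose M = M" and S: "subspace S"
    and inv: "\<And>x. x \<in> S \<Longrightarrow> M *v x \<in> S" and w: "w \<in> S" "w \<noteq> 0"
  obtains x \<mu> where "x \<in> S" "x \<noteq> 0" "x \<in> eigenspace M \<mu>"
proof -
  let ?K = "S \<inter> sphere 0 1"
  have "compact ?K"
    using closed_subspace[OF S] by (simp add: closed_Int_compact)
  moreover have "(1 / norm w) *\<^sub>R w \<in> ?K"
    using w S by (simp add: subspace_scale)
  moreover have "continuous_on ?K (\<lambda>x. x \<bullet> (M *v x))"
    by (intro continuous_intros linear_continuous_on matrix_vector_mul_bounded_linear)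
  ultimately obtain x where x: "x \<in> ?K" and max: "\<And>y. y \<in> ?K \<Longrightarrow> y \<bullet> (M *v y) \<le> x \<bullet> (M *v x)"
    using continuous_attains_sup[of ?K "\<lambda>x. x \<bullet> (M *v x)"] by blast
  define \<mu> where "\<mu> = x \<bullet> (M *v x)"
  have xS: "x \<in> S" and xx: "x \<bullet> x = 1"
    using x by (auto simp: dot_square_norm)
  \<comment> \<open>Homogeneity carries the bound from the unit sphere to all of
    \<open>S\<close>.\<close>
  have le: "y \<bullet> (M *v y) \<le> \<mu> * (y \<bullet> y)" if "y \<in> S" for y
  proof (cases "y = 0")
    case False
    have "(1 / norm y) *\<^sub>R y \<in> ?K"
      using False that S by (simp add: subspace_scale)
    from max[OF this] have "(y \<bullet> (M *v y)) / (norm y)\<^sup>2 \<le> \<mu>"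
      by (simp add: \<mu>_def matrix_vector_mult_scaleR power2_eq_square)
    then show ?thesis
      using False by (simp add: divide_le_eq dot_square_norm)
  qed simp
  \<comment> \<open>The form \<open>\<mu> * (y \<bullet> y) - y \<bullet> (M *v y)\<close> is
    nonnegative on \<open>S\<close> and vanishes at \<open>x\<close>. Its gradient there is
    \<open>2 *\<^sub>R z\<close>, which lies in \<open>S\<close> and so has to vanish;
    \<open>q\<close> is the value of the form at \<open>z\<close>.\<close>
  define z where "z = \<mu> *\<^sub>R x - M *v x"
  define q where "q = \<mu> * (z \<bullet> z) - z \<bullet> (M *v z)"
  have zS: "z \<in> S"
    unfolding z_def using S xS inv by (simp add: subspace_diff subspace_scale)
  have q: "q \<ge> 0"
    using le[OF zS] by (simp add: q_def)
  \<comment> \<open>This is \<open>le\<close> at \<open>x + t *\<^sub>R z\<close>: the constant term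
    cancels because \<open>x \<bullet> x = 1\<close>, and symmetry of \<open>M\<close> makes the
    linear coefficient \<open>2 * (z \<bullet> z)\<close>.\<close>
  have quad: "0 \<le> 2 * t * (z \<bullet> z) + t\<^sup>2 * q" for t
  proof -
    have "z \<bullet> (\<mu> *\<^sub>R x - M *v x) = \<mu> * (x \<bullet> z) - z \<bullet> (M *v x)"
      by (simp add: inner_diff_right inner_commute[of z x])
    then have zz: "z \<bullet> z = \<mu> * (x \<bullet> z) - z \<bullet> (M *v x)"
      unfolding z_def[symmetric] .
    have "x \<bullet> (M *v z) = z \<bullet> (M *v x)"
      using inner_symmetric_matrix[OF sym, of x z] by (simp add: inner_commute)
    moreover have "0 \<le> \<mu> * ((x + t *\<^sub>R z) \<bullet> (x + t *\<^sub>R z)) - (x + t *\<^sub>R z) \<bullet> (M *v (x + t *\<^sub>R z))"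
      using le[of "x + t *\<^sub>R z"] S xS zS by (simp add: subspace_add subspace_scale)
    ultimately have "0 \<le> 2 * t * (\<mu> * (x \<bullet> z) - z \<bullet> (M *v x)) + t\<^sup>2 * q"
      using xx unfolding q_def
      by (simp add: matrix_vector_right_distrib matrix_vector_mult_scaleR inner_add_left
          inner_add_right inner_commute[of z x] \<mu>_def[symmetric] algebra_simps power2_eq_square)
    then show ?thesis by (simp only: zz)
  qed
  have "z \<bullet> z \<le> 0"
  proof (rule ccontr)
    define n where "n = z \<bullet> z"
    assume "\<not> z \<bullet> z \<le> 0"
    then have n: "n > 0" by (simp only: n_def not_le)
    \<comment> \<open>At \<open>t = - s\<close> with \<open>s\<close> this small the negative linear
      term outweighs the quadratic one. The summand 1 keeps the denominator positive when
      \<open>q = 0\<close> and gives \<open>s * q < n\<close>.\<close>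
    define s where "s = n / (q + 1)"
    have s: "s > 0" "s * q < n"
      using n q by (auto simp: s_def field_simps)
    have "0 \<le> s * (s * q - 2 * n)"
      using quad[of "- s"] by (simp add: n_def algebra_simps power2_eq_square)
    then show False
      using s n by (simp add: zero_le_mult_iff)
  qed
  then have "z = 0"
    by (metis inner_ge_zero inner_eq_zero_iff order_antisym)
  then have "x \<in> eigenspace M \<mu>"
    by (simp add: z_def eigenspace_def)
  moreover have "x \<noteq> 0" using xx by auto
  ultimately show thesis using that xS by blast
qed

text \<open>By symmetry, the orthogonal complement of all eigenspaces is invariant under
  \<open>M\<close>. If it were nonzero it would contain an eigenvector, and this vector would be
  orthogonal to itself.\<close>

lemma span_eigenspaces:
  fixes M :: "real^'n^'n::finite"
  assumes sym: "transpose M = M"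
  shows "span (\<Union>\<mu>. eigenspace M \<mu>) = UNIV"
proof (rule ccontr)
  let ?E = "\<Union>\<mu>. eigenspace M \<mu>"
  let ?S = "{x. \<forall>y\<in>?E. orthogonal y x}"
  assume "span ?E \<noteq> UNIV"
  then obtain x where x: "x \<notin> span ?E" by auto
  obtain p z where pz: "p \<in> span ?E" "\<And>w. w \<in> span ?E \<Longrightarrow> orthogonal z w" "x = p + z"
    using orthogonal_subspace_decomp_exists[of ?E x] by metis
  have z: "z \<noteq> 0" "z \<in> ?S"
    using x pz span_base[of _ ?E] by (auto simp: orthogonal_commute)
  have sub: "subspace ?S"
    by (rule subspace_orthogonal_to_vectors)
  have inv: "M *v y \<in> ?S" if "y \<in> ?S" for y
  proof -
    have "orthogonal w (M *v y)" if "w \<in> eigenspace M \<mu>" for w \<mu>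
    proof -
      have "w \<bullet> (M *v y) = \<mu> * (w \<bullet> y)"
        using inner_symmetric_matrix[OF sym, of w y] that by (simp add: eigenspace_def)
      also have "w \<bullet> y = 0"
        using \<open>y \<in> ?S\<close> that by (auto simp: orthogonal_def)
      finally show ?thesis by (simp add: orthogonal_def)
    qed
    then show ?thesis by blast
  qed
  obtain y \<mu> where y: "y \<in> ?S" "y \<noteq> 0" "y \<in> eigenspace M \<mu>"
    using invariant_subspace_contains_eigenvector[OF sym sub inv z(2,1)] .
  then have "orthogonal y y" by blast
  then show False using y(2) by (simp add: orthogonal_def)
qed

text \<open>One eigenvector chosen for each eigenvalue gives nonzero, pairwise orthogonal, hence
  independent vectors, of which there are only finitely many.\<close>

lemma finite_eigenvalues:
  fixes M :: "real^'n^'n::finite"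
  assumes sym: "transpose M = M"
  shows "finite (eigenvalues M)"
proof -
  obtain f where f: "\<And>\<mu>. \<mu> \<in> eigenvalues M \<Longrightarrow> f \<mu> \<in> eigenspace M \<mu> \<and> f \<mu> \<noteq> 0"
    using that[of "\<lambda>\<mu>. SOME x. x \<in> eigenspace M \<mu> \<and> x \<noteq> 0"]
    unfolding eigenvalues_def by (metis (mono_tags, lifting) mem_Collect_eq)
  have orth: "f \<mu> \<bullet> f \<nu> = 0" if "\<mu> \<in> eigenvalues M" "\<nu> \<in> eigenvalues M" "\<mu> \<noteq> \<nu>" for \<mu> \<nu>
    using eigenspaces_orthogonal[OF sym] f that by blast
  have "inj_on f (eigenvalues M)"
    by (rule inj_onI) (metis f inner_eq_zero_iff orth)
  moreover have "pairwise orthogonal (f ` eigenvalues M)"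
    by (auto simp: pairwise_def orthogonal_def) (metis orth)
  then have "independent (f ` eigenvalues M)"
    by (rule pairwise_orthogonal_independent) (use f in auto)
  then have "finite (f ` eigenvalues M)"
    by (rule independent_imp_finite)
  ultimately show ?thesis by (simp add: finite_image_iff)
qed

section \<open>Eigenprojections and the resolution of the identity\<close>

lemma eigenprojection_in_eigenspace: "eigenprojection M \<mu> *v x \<in> eigenspace M \<mu>"
  using eigenprojection[of M \<mu>] by (simp add: is_orth_projection_def)

lemma inner_eigenprojection:
  assumes "y \<in> eigenspace M \<mu>"
  shows "(eigenprojection M \<mu> *v x) \<bullet> y = x \<bullet> y"
proof -
  have "(x - eigenprojection M \<mu> *v x) \<bullet> y = 0"
    using eigenprojection[of M \<mu>] assms unfolding is_orth_projection_def orthogonal_def by blast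
  then show ?thesis by (simp add: inner_diff_left)
qed

lemma eigenprojection_self:
  assumes "x \<in> eigenspace M \<mu>"
  shows "eigenprojection M \<mu> *v x = x"
proof -
  let ?d = "x - eigenprojection M \<mu> *v x"
  have "?d \<in> eigenspace M \<mu>"
    by (intro subspace_diff subspace_eigenspace assms eigenprojection_in_eigenspace)
  from inner_eigenprojection[OF this, of x] have "?d \<bullet> ?d = 0"
    by (simp add: inner_diff_left)
  then show ?thesis by simp
qed

lemma eigenprojection_eq_0:
  assumes "\<And>y. y \<in> eigenspace M \<mu> \<Longrightarrow> x \<bullet> y = 0"
  shows "eigenprojection M \<mu> *v x = 0"
  using inner_eigenprojection[OF eigenprojection_in_eigenspace, of M \<mu> x x]
    assms[OF eigenprojection_in_eigenspace] by simp

text \<open>Both entries equal the inner product of the projections of the two basis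
  vectors.\<close>

lemma eigenprojection_symmetric: "eigenprojection M \<mu> $ i $ j = eigenprojection M \<mu> $ j $ i"
proof -
  let ?E = "eigenprojection M \<mu>"
  have "(?E *v axis j 1) \<bullet> axis i 1 = (?E *v axis j 1) \<bullet> (?E *v axis i 1)" for i j
    using inner_eigenprojection[OF eigenprojection_in_eigenspace, of M \<mu> "axis i 1" "axis j 1"]
    by (simp add: inner_commute)
  from this[of j i] this[of i j] show ?thesis
    by (simp add: inner_commute[of "?E *v axis i 1" "?E *v axis j 1"] inner_axis
        matrix_vector_mult_axis_nth)
qed

text \<open>Both sides are linear in \<open>x\<close>, so eigenvectors suffice, as they span. On an
  eigenvector only the projection for its own eigenvalue survives.\<close>

lemma sum_eigenprojections:
  fixes M :: "real^'n^'n::finite"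
  assumes sym: "transpose M = M"
  shows "(\<Sum>\<mu>\<in>eigenvalues M. eigenprojection M \<mu> *v x) = x"
proof -
  have "x \<in> span (\<Union>\<mu>. eigenspace M \<mu>)"
    by (simp add: span_eigenspaces[OF sym])
  then show ?thesis
  proof (induction rule: span_induct)
    case base
    show ?case
      by (auto simp: subspace_def matrix_vector_right_distrib sum.distrib
          matrix_vector_mult_scaleR scaleR_sum_right[symmetric])
  next
    case (step x)
    then obtain \<nu> where \<nu>: "x \<in> eigenspace M \<nu>" by auto
    show ?case
    proof (cases "x = 0")
      case False
      then have "\<nu> \<in> eigenvalues M"
        using \<nu> by (auto simp: eigenvalues_def)
      moreover have "eigenprojection M \<mu> *v x = (if \<mu> = \<nu> then x else 0)" for \<mu>
        using eigenprojection_self[OF \<nu>] eigenspaces_orthogonal[OF sym \<nu>]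
        by (auto intro: eigenprojection_eq_0)
      ultimately show ?thesis
        using finite_eigenvalues[OF sym] by simp
    qed simp
  qed
qed

section \<open>Spectral expansion of the transition matrix\<close>

lemma matrix_pow_eigenexpansion:
  fixes M :: "real^'n^'n::finite"
  assumes sym: "transpose M = M"
  shows "matrix_pow (map_matrix (\<lambda>x. c * of_real x) M) k $ i $ j =
    (\<Sum>\<mu>\<in>eigenvalues M. (c * of_real \<mu>) ^ k * of_real (eigenprojection M \<mu> $ i $ j))"
proof (induction k arbitrary: i)
  case 0
  have "(\<Sum>\<mu>\<in>eigenvalues M. eigenprojection M \<mu> $ i $ j) = (axis j 1 :: real^'n) $ i"
    using arg_cong[OF sum_eigenprojections[OF sym, of "axis j 1"], of "\<lambda>x. x $ i"]
    by (simp add: matrix_vector_mult_axis_nth)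
  then show ?case
    by (simp add: mat_def axis_def flip: of_real_sum)
next
  case (Suc k)
  \<comment> \<open>Columns of the projection are eigenvectors, so multiplying by \<open>M\<close>
    produces one more factor \<open>\<mu>\<close>.\<close>
  have E: "(\<Sum>l\<in>UNIV. M $ i $ l * eigenprojection M \<mu> $ l $ j) = \<mu> * eigenprojection M \<mu> $ i $ j" for \<mu>
    using arg_cong[of _ _ "\<lambda>x. x $ i",
        OF eigenprojection_in_eigenspace[of M \<mu> "axis j 1", unfolded eigenspace_def mem_Collect_eq]]
    unfolding matrix_vector_mult_def[of M]
    by (simp add: matrix_vector_mult_axis_nth)
  have "matrix_pow (map_matrix (\<lambda>x. c * of_real x) M) (Suc k) $ i $ j =
      (\<Sum>l\<in>UNIV. \<Sum>\<mu>\<in>eigenvalues M. c * (c * of_real \<mu>) ^ k *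
        of_real (M $ i $ l * eigenprojection M \<mu> $ l $ j))"
    by (simp add: matrix_matrix_mult_def Suc sum_distrib_left mult_ac)
  also have "\<dots> = (\<Sum>\<mu>\<in>eigenvalues M. c * (c * of_real \<mu>) ^ k *
        of_real (\<Sum>l\<in>UNIV. M $ i $ l * eigenprojection M \<mu> $ l $ j))"
    by (subst sum.swap) (simp add: sum_distrib_left)
  finally show ?case
    by (simp add: E mult_ac)
qed

lemma sums_matrix_componentwise:
  fixes f :: "nat \<Rightarrow> complex^'n^'m"
  assumes "\<And>i j. (\<lambda>k. f k $ i $ j) sums (s $ i $ j)"
  shows "f sums s"
  using assms unfolding sums_def
  by (auto intro!: vec_tendstoI)

text \<open>The sum over eigenvalues is finite, so in each entry the exponential series may be
  summed separately for each eigenvalue.\<close>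

lemma transition_matrix_eigenexpansion:
  fixes M :: "real^'n^'n::finite"
  assumes sym: "transpose M = M"
  shows "transition_matrix M t $ i $ j =
    (\<Sum>\<mu>\<in>eigenvalues M. exp (\<i> * of_real (t * \<mu>)) * of_real (eigenprojection M \<mu> $ i $ j))"
proof -
  let ?B = "map_matrix (\<lambda>x. \<i> * of_real t * of_real x) M"
  let ?s = "\<lambda>i j. \<Sum>\<mu>\<in>eigenvalues M.
    exp (\<i> * of_real (t * \<mu>)) * of_real (eigenprojection M \<mu> $ i $ j)"
  have "(\<lambda>k. (1 / fact k) *\<^sub>R matrix_pow ?B k) sums (\<chi> i j. ?s i j)"
  proof (rule sums_matrix_componentwise)
    fix i j
    have "(\<lambda>k. \<Sum>\<mu>\<in>eigenvalues M. (\<i> * of_real (t * \<mu>)) ^ k /\<^sub>R fact k *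
        of_real (eigenprojection M \<mu> $ i $ j)) sums ?s i j"
      by (intro sums_sum sums_mult2 exp_converges)
    moreover have "((1 / fact k) *\<^sub>R matrix_pow ?B k) $ i $ j =
        (\<Sum>\<mu>\<in>eigenvalues M. (\<i> * of_real (t * \<mu>)) ^ k /\<^sub>R fact k *
          of_real (eigenprojection M \<mu> $ i $ j))" for k
      unfolding vector_scaleR_component matrix_pow_eigenexpansion[OF sym] scaleR_sum_right
      by (simp add: inverse_eq_divide mult_ac)
    ultimately show "(\<lambda>k. ((1 / fact k) *\<^sub>R matrix_pow ?B k) $ i $ j) sums ((\<chi> i j. ?s i j) $ i $ j)"
      by simp
  qed
  then show ?thesis
    by (simp add: transition_matrix_def matrix_exp_def sums_unique[symmetric])
qed

section \<open>Testing fractional revival on eigenvectors\<close>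

lemma fractional_revival_componentwise:
  fixes M :: "real^'n^'n::finite"
  shows
  "fractional_revival M \<alpha> \<beta> u v \<tau> \<longleftrightarrow>
    (\<forall>i. transition_matrix M \<tau> $ i $ u =
      \<alpha> * of_real (axis u 1 $ i) + \<beta> * of_real (axis v 1 $ i))"
proof -
  have "axis a 1 $ i = (of_real (axis a 1 $ i) :: complex)" for a i :: 'n
    by (simp add: axis_def)
  then show ?thesis
    unfolding fractional_revival_def vec_eq_iff matrix_vector_mult_axis_nth
      vector_add_component vector_smult_component by metis
qed

text \<open>Forward: column \<open>u\<close> of the transition matrix is paired with
  \<open>y\<close>. Backward: the test is applied to the projections of each
  \<open>axis i 1\<close>, and the results are summed over all eigenvalues.\<close>

lemma fractional_revival_iff_eigenvectors:
  fixes M :: "real^'n^'n::finite"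
  assumes sym: "transpose M = M"
  shows "fractional_revival M \<alpha> \<beta> u v \<tau> \<longleftrightarrow>
    (\<forall>\<mu>. \<forall>y\<in>eigenspace M \<mu>.
      exp (\<i> * of_real (\<tau> * \<mu>)) * of_real (y $ u) = \<alpha> * of_real (y $ u) + \<beta> * of_real (y $ v))"
    (is "_ \<longleftrightarrow> ?R")
proof
  assume fr: "fractional_revival M \<alpha> \<beta> u v \<tau>"
  show ?R
  proof (intro allI ballI)
    fix \<mu> y assume y: "y \<in> eigenspace M \<mu>"
    \<comment> \<open>By symmetry of the projection the sum is the entry at \<open>u\<close> of the
      projection of \<open>y\<close>, so only the phase of \<open>\<mu>\<close> survives.\<close>
    have *: "(\<Sum>i\<in>UNIV. y $ i * eigenprojection M \<nu> $ i $ u) = (if \<nu> = \<mu> then y $ u else 0)" for \<nu>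
    proof -
      have "(\<Sum>i\<in>UNIV. y $ i * eigenprojection M \<nu> $ i $ u) = (eigenprojection M \<nu> *v y) $ u"
        by (simp add: matrix_vector_mult_def eigenprojection_symmetric[of M \<nu> u] mult_ac)
      also have "eigenprojection M \<nu> *v y = (if \<nu> = \<mu> then y else 0)"
        using eigenprojection_self[OF y] eigenspaces_orthogonal[OF sym y]
        by (auto intro: eigenprojection_eq_0)
      finally show ?thesis by simp
    qed
    have "(\<Sum>i\<in>UNIV. of_real (y $ i) * transition_matrix M \<tau> $ i $ u) =
        (\<Sum>\<nu>\<in>eigenvalues M. exp (\<i> * of_real (\<tau> * \<nu>)) *
          of_real (\<Sum>i\<in>UNIV. y $ i * eigenprojection M \<nu> $ i $ u))"
      unfolding transition_matrix_eigenexpansion[OF sym] sum_distrib_left of_real_sum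
      by (subst sum.swap) (simp add: mult_ac)
    also have "\<dots> = (\<Sum>\<nu>\<in>eigenvalues M. if \<nu> = \<mu> then exp (\<i> * of_real (\<tau> * \<mu>)) * of_real (y $ u) else 0)"
      unfolding * by (intro sum.cong) auto
    also have "\<dots> = exp (\<i> * of_real (\<tau> * \<mu>)) * of_real (y $ u)"
      using finite_eigenvalues[OF sym] y by (auto simp: eigenvalues_def)
    finally have "exp (\<i> * of_real (\<tau> * \<mu>)) * of_real (y $ u) =
        (\<Sum>i\<in>UNIV. of_real (y $ i) * (\<alpha> * of_real (axis u 1 $ i) + \<beta> * of_real (axis v 1 $ i)))"
      using fr by (simp add: fractional_revival_componentwise)
    also have "\<dots> = \<alpha> * of_real (y \<bullet> axis u 1) + \<beta> * of_real (y \<bullet> axis v 1)"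
      unfolding inner_vec_def of_real_sum sum_distrib_left sum.distrib[symmetric]
      by (rule sum.cong) (simp_all add: distrib_left)
    also have "\<dots> = \<alpha> * of_real (y $ u) + \<beta> * of_real (y $ v)"
      by (simp add: inner_axis)
    finally show "exp (\<i> * of_real (\<tau> * \<mu>)) * of_real (y $ u) =
        \<alpha> * of_real (y $ u) + \<beta> * of_real (y $ v)" .
  qed
next
  assume R: ?R
  show "fractional_revival M \<alpha> \<beta> u v \<tau>"
    unfolding fractional_revival_componentwise
  proof
    fix i
    have col: "eigenprojection M \<mu> $ k $ i = (eigenprojection M \<mu> *v axis i 1) $ k" for \<mu> k
      by (simp add: matrix_vector_mult_axis_nth)
    have res: "(\<Sum>\<mu>\<in>eigenvalues M. (eigenprojection M \<mu> *v axis i 1) $ k) = axis k 1 $ i" for k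
      using arg_cong[OF sum_eigenprojections[OF sym, of "axis i 1"], of "\<lambda>x. x $ k"]
      by (simp add: axis_def eq_commute[of k i])
    have "transition_matrix M \<tau> $ i $ u = (\<Sum>\<mu>\<in>eigenvalues M.
        exp (\<i> * of_real (\<tau> * \<mu>)) * of_real ((eigenprojection M \<mu> *v axis i 1) $ u))"
      by (simp add: transition_matrix_eigenexpansion[OF sym] eigenprojection_symmetric[of M _ i u] col)
    also have "\<dots> = (\<Sum>\<mu>\<in>eigenvalues M. \<alpha> * of_real ((eigenprojection M \<mu> *v axis i 1) $ u) +
        \<beta> * of_real ((eigenprojection M \<mu> *v axis i 1) $ v))"
      using R eigenprojection_in_eigenspace by (intro sum.cong) blast+
    also have "\<dots> = \<alpha> * of_real (axis u 1 $ i) + \<beta> * of_real (axis v 1 $ i)"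
      by (simp add: sum.distrib res flip: sum_distrib_left of_real_sum)
    finally show "transition_matrix M \<tau> $ i $ u =
        \<alpha> * of_real (axis u 1 $ i) + \<beta> * of_real (axis v 1 $ i)" .
  qed
qed

section \<open>Twin vertices and their eigenvector\<close>

lemma transpose_graph_matrix:
  assumes "undirected W"
  shows "transpose (graph_matrix K W) = graph_matrix K W"
  using assms
  by (cases K) (auto simp: transpose_def degree_matrix_def undirected_def vec_eq_iff)

text \<open>Twins share neighbours outside the pair, so for a non-neighbour both weights are
  0.\<close>

lemma twins_weight_eq:
  assumes "twins W u v" "w \<noteq> u" "w \<noteq> v"
  shows "W $ u $ w = W $ v $ w"
proof (cases "w \<in> neighbours W u")
  case False
  then have "w \<notin> neighbours W v" using assms by (auto simp: twins_def)
  with False show ?thesis by (simp add: neighbours_def edges_def)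
qed (use assms in \<open>auto simp: twins_def\<close>)

lemma twins_deg_eq:
  assumes "undirected W" "twins W u v"
  shows "deg W u = deg W v"
proof -
  have uv: "u \<noteq> v" "W $ u $ u = W $ v $ v" "W $ u $ v = W $ v $ u"
    using assms by (auto simp: twins_def undirected_def)
  have "(\<Sum>b\<in>UNIV - {u}. W $ u $ b) = W $ u $ v + (\<Sum>b\<in>UNIV - {u, v}. W $ u $ b)"
    using uv by (subst sum.remove[of _ v]) (auto simp: Diff_insert2[symmetric] insert_commute)
  moreover have "(\<Sum>b\<in>UNIV - {v}. W $ v $ b) = W $ v $ u + (\<Sum>b\<in>UNIV - {u, v}. W $ v $ b)"
    using uv by (subst sum.remove[of _ u]) (auto simp: Diff_insert2[symmetric] insert_commute)
  moreover have "(\<Sum>b\<in>UNIV - {u, v}. W $ u $ b) = (\<Sum>b\<in>UNIV - {u, v}. W $ v $ b)"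
    by (intro sum.cong) (auto intro: twins_weight_eq[OF assms(2)])
  ultimately show ?thesis using uv by (simp add: deg_def)
qed

text \<open>Columns \<open>u\<close> and \<open>v\<close> of the matrix agree outside rows
  \<open>u\<close> and \<open>v\<close>; in these two rows their difference is plus or minus the
  twin eigenvalue, because the loops and degrees of twins coincide.\<close>

lemma twins_eigenvector:
  assumes "undirected W" "twins W u v"
  shows "axis u 1 - axis v 1 \<in> eigenspace (graph_matrix K W) (twin_eigenvalue K W u v)"
proof -
  have uv: "u \<noteq> v" "W $ u $ u = W $ v $ v" "W $ u $ v = W $ v $ u"
    using assms by (auto simp: twins_def undirected_def)
  have w: "W $ i $ u = W $ i $ v" if "i \<noteq> u" "i \<noteq> v" for i
    using twins_weight_eq[OF assms(2) that] assms(1) by (simp add: undirected_def)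
  have "graph_matrix K W $ i $ u - graph_matrix K W $ i $ v =
      twin_eigenvalue K W u v * (axis u 1 $ i - axis v 1 $ i)" for i
  proof -
    consider "i = u" | "i = v" | "i \<noteq> u" "i \<noteq> v" by blast
    then show ?thesis
      by cases (use uv w twins_deg_eq[OF assms] in \<open>cases K; simp add: degree_matrix_def axis_def\<close>)+
  qed
  then show ?thesis
    by (simp add: eigenspace_def vec_eq_iff matrix_vector_mult_diff_distrib
        matrix_vector_mult_axis_nth)
qed

section \<open>Phases, and revival between vertices whose difference is an eigenvector\<close>

lemma exp_ii_eq_iff_rcong:
  "exp (\<i> * of_real x) = exp (\<i> * of_real y) \<longleftrightarrow> [x = y] (rmod (2 * pi))"
proof -
  have "exp (\<i> * of_real x) = exp (\<i> * of_real y) \<longleftrightarrow> (\<exists>n::int. x = y + of_int (2 * n) * pi)"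
    unfolding exp_eq by (intro ex_cong1) (auto simp: complex_eq_iff)
  also have "\<dots> \<longleftrightarrow> [x = y] (rmod (2 * pi))"
    by (subst rcong_sym_iff) (simp add: rcong_altdef mult_ac)
  finally show ?thesis .
qed

context
  fixes M :: "real^'n^'n::finite" and u v :: 'n and \<theta> :: real
  assumes sym: "transpose M = M" and neq: "u \<noteq> v"
    and eigvec: "axis u 1 - axis v 1 \<in> eigenspace M \<theta>"
begin

lemma eigenvector_eq_at_twins:
  assumes "y \<in> eigenspace M \<mu>" "\<mu> \<noteq> \<theta>"
  shows "y $ u = y $ v"
  using eigenspaces_orthogonal[OF sym assms(1) eigvec assms(2)]
  by (simp add: inner_diff_right inner_axis)

lemma eigenprojection_eq_at_twins:
  assumes "\<mu> \<noteq> \<theta>"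
  shows "eigenprojection M \<mu> *v axis u 1 = eigenprojection M \<mu> *v axis v 1"
proof -
  have "eigenprojection M \<mu> *v (axis u 1 - axis v 1) = 0"
    using eigenvector_eq_at_twins assms
    by (intro eigenprojection_eq_0) (auto simp: inner_diff_left inner_axis')
  then show ?thesis by (simp add: matrix_vector_mult_diff_distrib)
qed

text \<open>Either side says that \<open>axis u 1 + axis v 1\<close> is orthogonal to the eigenspace
  of \<open>\<theta>\<close>.\<close>

lemma eigenprojection_neg_at_twins_iff:
  "eigenprojection M \<theta> *v axis u 1 = - (eigenprojection M \<theta> *v axis v 1) \<longleftrightarrow>
    (\<forall>y\<in>eigenspace M \<theta>. y $ u = - y $ v)" (is "?L \<longleftrightarrow> ?R")
proof
  assume L: ?L
  show ?R
  proof
    fix y assume y: "y \<in> eigenspace M \<theta>"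
    show "y $ u = - y $ v"
      using inner_eigenprojection[OF y, of "axis u 1"] inner_eigenprojection[OF y, of "axis v 1"] L
      by (simp add: inner_axis')
  qed
next
  assume R: ?R
  have "eigenprojection M \<theta> *v (axis u 1 + axis v 1) = 0"
    using R by (intro eigenprojection_eq_0) (auto simp: inner_add_left inner_axis')
  then show ?L by (simp add: matrix_vector_right_distrib eq_neg_iff_add_eq_0)
qed

lemma fractional_revival_exp_theta:
  assumes "fractional_revival M \<alpha> \<beta> u v \<tau>"
  shows "exp (\<i> * of_real (\<tau> * \<theta>)) = \<alpha> - \<beta>"
  using assms[unfolded fractional_revival_iff_eigenvectors[OF sym], rule_format, OF eigvec] neq
  by (simp add: axis_def)

text \<open>With the phase of \<open>\<theta>\<close> equal to \<open>\<alpha> - \<beta>\<close>,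
  the terms in \<open>\<alpha>\<close> cancel from the test and \<open>\<beta>\<close> times the sum
  of the two entries remains.\<close>

lemma proper_fractional_revival_neg:
  assumes "fractional_revival M \<alpha> \<beta> u v \<tau>" "\<beta> \<noteq> 0"
  shows "eigenprojection M \<theta> *v axis u 1 = - (eigenprojection M \<theta> *v axis v 1)"
  unfolding eigenprojection_neg_at_twins_iff
proof
  fix y assume y: "y \<in> eigenspace M \<theta>"
  have "\<beta> * of_real (y $ u + y $ v) = 0"
    using assms(1)[unfolded fractional_revival_iff_eigenvectors[OF sym], rule_format, OF y]
    unfolding fractional_revival_exp_theta[OF assms(1)] by (simp add: algebra_simps)
  then show "y $ u = - y $ v"
    using assms(2) by (simp only: mult_eq_0_iff of_real_eq_0_iff) simp
qed

text \<open>The test vector is the projection of \<open>axis u 1\<close>: its entry at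
  \<open>u\<close> is its own squared norm, nonzero on the support, and can be cancelled.\<close>

lemma fractional_revival_exp_support:
  assumes "fractional_revival M \<alpha> \<beta> u v \<tau>" "\<mu> \<in> eigenvalue_support M u" "\<mu> \<noteq> \<theta>"
  shows "exp (\<i> * of_real (\<tau> * \<mu>)) = \<alpha> + \<beta>"
proof -
  let ?y = "eigenprojection M \<mu> *v axis u 1"
  have y: "?y \<in> eigenspace M \<mu>" by (rule eigenprojection_in_eigenspace)
  have "?y \<bullet> ?y = ?y $ u"
    using inner_eigenprojection[OF y, of "axis u 1"] by (simp add: inner_axis')
  then have "?y $ u \<noteq> 0"
    using assms(2) by (auto simp: eigenvalue_support_def)
  moreover have "exp (\<i> * of_real (\<tau> * \<mu>)) * of_real (?y $ u) = (\<alpha> + \<beta>) * of_real (?y $ u)"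
    using assms(1)[unfolded fractional_revival_iff_eigenvectors[OF sym], rule_format, OF y]
      eigenvector_eq_at_twins[OF y assms(3)] by (simp add: distrib_right)
  ultimately show ?thesis by simp
qed

lemma fractional_revivalI_twins:
  assumes neg: "eigenprojection M \<theta> *v axis u 1 = - (eigenprojection M \<theta> *v axis v 1)"
    and \<theta>: "exp (\<i> * of_real (\<tau> * \<theta>)) = \<alpha> - \<beta>"
    and supp: "\<And>\<mu>. \<mu> \<in> eigenvalue_support M u \<Longrightarrow> \<mu> \<noteq> \<theta> \<Longrightarrow> exp (\<i> * of_real (\<tau> * \<mu>)) = \<alpha> + \<beta>"
  shows "fractional_revival M \<alpha> \<beta> u v \<tau>"
  unfolding fractional_revival_iff_eigenvectors[OF sym]
proof (intro allI ballI)
  fix \<mu> y assume y: "y \<in> eigenspace M \<mu>"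
  show "exp (\<i> * of_real (\<tau> * \<mu>)) * of_real (y $ u) = \<alpha> * of_real (y $ u) + \<beta> * of_real (y $ v)"
  proof (cases "\<mu> = \<theta>")
    case True
    then have "y $ v = - y $ u"
      using neg y unfolding eigenprojection_neg_at_twins_iff by auto
    then show ?thesis
      unfolding True \<theta> by (simp add: algebra_simps)
  next
    case False
    \<comment> \<open>Off the support the phase of \<open>\<mu>\<close> is unconstrained, but the
      entries at \<open>u\<close> and \<open>v\<close> are both 0 and the test is trivial.\<close>
    have "y $ u = 0" if "\<mu> \<notin> eigenvalue_support M u"
    proof (cases "y = 0")
      case False
      then have "eigenprojection M \<mu> *v axis u 1 = 0"
        using that y by (auto simp: eigenvalue_support_def eigenvalues_def)
      then show ?thesis
        using inner_eigenprojection[OF y, of "axis u 1"] by (simp add: inner_axis')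
    qed simp
    then show ?thesis
      using supp[OF _ False] eigenvector_eq_at_twins[OF y False]
      by (cases "\<mu> \<in> eigenvalue_support M u") (auto simp: distrib_right)
  qed
qed

text \<open>Away from \<open>\<theta>\<close> the two projections always agree, so
  \<open>neg\<close> supplies the one missing sign. Since a nonzero vector differs from its
  negative, no eigenvalue can carry both signs.\<close>

lemma twins_strong_cospectrality:
  assumes neg: "eigenprojection M \<theta> *v axis u 1 = - (eigenprojection M \<theta> *v axis v 1)"
    and \<theta>: "\<theta> \<in> eigenvalue_support M u"
  shows "strongly_cospectral M u v"
    and "support_plus M u v = eigenvalue_support M u - {\<theta>}"
    and "support_minus M u v = {\<theta>}"
proof -
  note pos = eigenprojection_eq_at_twins
  have ne': "x \<noteq> - x" if "x \<noteq> 0" for x :: "real^'n"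
    using that by (auto simp: vec_eq_iff)
  have ne: "eigenprojection M \<theta> *v axis v 1 \<noteq> - (eigenprojection M \<theta> *v axis v 1)"
    using \<theta> neg by (intro ne') (auto simp: eigenvalue_support_def)
  show "strongly_cospectral M u v"
    using pos neg unfolding strongly_cospectral_def by metis
  show "support_plus M u v = eigenvalue_support M u - {\<theta>}"
    using pos neg ne by (auto simp: support_plus_def eigenvalue_support_def)
  show "support_minus M u v = {\<theta>}"
  proof
    show "support_minus M u v \<subseteq> {\<theta>}"
      using pos ne' unfolding support_minus_def by fastforce
    show "{\<theta>} \<subseteq> support_minus M u v"
      using neg \<theta> by (auto simp: support_minus_def eigenvalue_support_def)
  qed
qed

end

text \<open>For the coefficients of the theorem this is \<open>\<alpha> + \<beta>\<close>; the next
  lemma gives \<open>\<alpha> - \<beta>\<close>. As both are pure phases, the test equations become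
  congruences modulo \<open>2 * pi\<close>.\<close>

lemma exp_cos_plus_i_sin:
  "exp (\<i> * of_real \<zeta>) * of_real (cos \<gamma>) + \<i> * exp (\<i> * of_real \<zeta>) * of_real (sin \<gamma>) =
    exp (\<i> * of_real (\<zeta> + \<gamma>))"
  by (simp add: exp_add distrib_left exp_Euler cos_of_real sin_of_real algebra_simps)

lemma exp_cos_minus_i_sin:
  "exp (\<i> * of_real \<zeta>) * of_real (cos \<gamma>) - \<i> * exp (\<i> * of_real \<zeta>) * of_real (sin \<gamma>) =
    exp (\<i> * of_real (\<zeta> - \<gamma>))"
  using exp_cos_plus_i_sin[of \<zeta> "- \<gamma>"] by simp

theorem theorem3p2:
  fixes W :: "'n::finite wgraph" and K :: matrix_kind and M :: "real^'n^'n"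
    and u v :: 'n and \<theta> :: real and lam :: "nat \<Rightarrow> real" and r :: nat
  assumes "undirected W" and "connected_graph W"
    and "M = graph_matrix K W"
    and "twins W u v"
    and "\<theta> = twin_eigenvalue K W u v"
    and "eigenvalue_support M u = insert \<theta> (lam ` {1..r})"
    and "inj_on lam {1..r}" and "\<theta> \<notin> lam ` {1..r}"
  shows
    "(\<forall>\<tau> \<zeta> \<gamma> :: real.
        proper_fractional_revival M
          (exp (\<i> * of_real \<zeta>) * of_real (cos \<gamma>)) (\<i> * exp (\<i> * of_real \<zeta>) * of_real (sin \<gamma>)) u v \<tau>
        \<longrightarrow>
        (strongly_cospectral M u v \<and>
         support_plus M u v = lam ` {1..r} \<and> support_minus M u v = {\<theta>}) \<and>
        (\<forall>j\<in>{1..r}. \<forall>k\<in>{1..r}.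
           [\<tau> * (lam j - lam k) = 0] (rmod (2 * pi)) \<and>
           [\<tau> * (lam j - \<theta>) = 2 * \<gamma>] (rmod (2 * pi))))
     \<and>
     (\<forall>\<tau> \<gamma> :: real.
        (strongly_cospectral M u v \<and>
         support_plus M u v = lam ` {1..r} \<and> support_minus M u v = {\<theta>}) \<and>
        (\<forall>j\<in>{1..r}. \<forall>k\<in>{1..r}.
           [\<tau> * (lam j - lam k) = 0] (rmod (2 * pi)) \<and>
           [\<tau> * (lam j - \<theta>) = 2 * \<gamma>] (rmod (2 * pi)))
        \<longrightarrow>
        (\<exists>\<zeta> :: real.
           fractional_revival M
             (exp (\<i> * of_real \<zeta>) * of_real (cos \<gamma>)) (\<i> * exp (\<i> * of_real \<zeta>) * of_real (sin \<gamma>)) u v \<tau> \<and>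
           (proper_fractional_revival M
              (exp (\<i> * of_real \<zeta>) * of_real (cos \<gamma>)) (\<i> * exp (\<i> * of_real \<zeta>) * of_real (sin \<gamma>)) u v \<tau>
            \<longleftrightarrow> (\<nexists>m :: int. \<gamma> = of_int m * pi))))"
proof -
  let ?\<alpha> = "\<lambda>\<zeta> \<gamma>. exp (\<i> * of_real \<zeta>) * of_real (cos \<gamma>) :: complex"
  let ?\<beta> = "\<lambda>\<zeta> \<gamma>. \<i> * exp (\<i> * of_real \<zeta>) * of_real (sin \<gamma>) :: complex"
  have sym: "transpose M = M"
    using assms by (simp add: transpose_graph_matrix)
  have neq: "u \<noteq> v" using assms by (simp add: twins_def)
  have eigvec: "axis u 1 - axis v 1 \<in> eigenspace M \<theta>"
    using assms twins_eigenvector by blast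
  note ctx = sym neq eigvec
  have \<theta>: "\<theta> \<in> eigenvalue_support M u" and lam: "lam ` {1..r} = eigenvalue_support M u - {\<theta>}"
    using assms by auto
  have supp: "lam j \<in> eigenvalue_support M u" "lam j \<noteq> \<theta>" if "j \<in> {1..r}" for j
    using lam that by blast+
  show ?thesis
  proof (rule conjI; intro allI impI)
    fix \<tau> \<zeta> \<gamma> :: real
    assume "proper_fractional_revival M (?\<alpha> \<zeta> \<gamma>) (?\<beta> \<zeta> \<gamma>) u v \<tau>"
    then have fr: "fractional_revival M (?\<alpha> \<zeta> \<gamma>) (?\<beta> \<zeta> \<gamma>) u v \<tau>" and "?\<beta> \<zeta> \<gamma> \<noteq> 0"
      by (auto simp: proper_fractional_revival_def)
    then have neg: "eigenprojection M \<theta> *v axis u 1 = - (eigenprojection M \<theta> *v axis v 1)"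
      by (rule proper_fractional_revival_neg[OF ctx])
    have c\<theta>: "[\<tau> * \<theta> = \<zeta> - \<gamma>] (rmod (2 * pi))"
      using fractional_revival_exp_theta[OF ctx fr]
      unfolding exp_cos_minus_i_sin exp_ii_eq_iff_rcong .
    have clam: "[\<tau> * lam j = \<zeta> + \<gamma>] (rmod (2 * pi))" if "j \<in> {1..r}" for j
      using fractional_revival_exp_support[OF ctx fr supp[OF that]]
      unfolding exp_cos_plus_i_sin exp_ii_eq_iff_rcong .
    show "(strongly_cospectral M u v \<and>
         support_plus M u v = lam ` {1..r} \<and> support_minus M u v = {\<theta>}) \<and>
        (\<forall>j\<in>{1..r}. \<forall>k\<in>{1..r}.
           [\<tau> * (lam j - lam k) = 0] (rmod (2 * pi)) \<and>
           [\<tau> * (lam j - \<theta>) = 2 * \<gamma>] (rmod (2 * pi)))"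
      \<comment> \<open>Subtracting two congruences eliminates \<open>\<zeta>\<close>: the
        right-hand sides leave 0 or \<open>2 * \<gamma>\<close>.\<close>
      using twins_strong_cospectrality[OF ctx neg \<theta>] lam
        rcong_diff[OF clam clam] rcong_diff[OF clam c\<theta>]
      by (simp add: right_diff_distrib)
  next
    fix \<tau> \<gamma> :: real
    assume A: "(strongly_cospectral M u v \<and>
         support_plus M u v = lam ` {1..r} \<and> support_minus M u v = {\<theta>}) \<and>
        (\<forall>j\<in>{1..r}. \<forall>k\<in>{1..r}.
           [\<tau> * (lam j - lam k) = 0] (rmod (2 * pi)) \<and>
           [\<tau> * (lam j - \<theta>) = 2 * \<gamma>] (rmod (2 * pi)))"
    \<comment> \<open>This solves \<open>\<tau> * \<theta> = \<zeta> - \<gamma>\<close>, the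
      requirement at \<open>\<theta>\<close>. It also covers \<open>r = 0\<close>, where condition
      (2) is vacuous.\<close>
    define \<zeta> where "\<zeta> = \<tau> * \<theta> + \<gamma>"
    have neg: "eigenprojection M \<theta> *v axis u 1 = - (eigenprojection M \<theta> *v axis v 1)"
      using A by (auto simp: support_minus_def)
    have fr: "fractional_revival M (?\<alpha> \<zeta> \<gamma>) (?\<beta> \<zeta> \<gamma>) u v \<tau>"
    proof (rule fractional_revivalI_twins[OF ctx neg])
      show "exp (\<i> * of_real (\<tau> * \<theta>)) = ?\<alpha> \<zeta> \<gamma> - ?\<beta> \<zeta> \<gamma>"
        unfolding exp_cos_minus_i_sin by (simp add: \<zeta>_def)
      fix \<mu> assume "\<mu> \<in> eigenvalue_support M u" "\<mu> \<noteq> \<theta>"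
      then obtain j where j: "j \<in> {1..r}" "\<mu> = lam j"
        using lam by blast
      then have "[\<tau> * (\<mu> - \<theta>) = 2 * \<gamma>] (rmod (2 * pi))"
        using A by blast
      then have "[\<tau> * (\<mu> - \<theta>) + \<tau> * \<theta> = 2 * \<gamma> + \<tau> * \<theta>] (rmod (2 * pi))"
        by (intro rcong_add) auto
      then have "[\<tau> * \<mu> = \<zeta> + \<gamma>] (rmod (2 * pi))"
        by (simp add: \<zeta>_def algebra_simps)
      then show "exp (\<i> * of_real (\<tau> * \<mu>)) = ?\<alpha> \<zeta> \<gamma> + ?\<beta> \<zeta> \<gamma>"
        unfolding exp_cos_plus_i_sin exp_ii_eq_iff_rcong .
    qed
    \<comment> \<open>The exponential factor never vanishes, so only the zeros of the sine
      matter.\<close>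
    moreover have "?\<beta> \<zeta> \<gamma> \<noteq> 0 \<longleftrightarrow> (\<nexists>m :: int. \<gamma> = of_int m * pi)"
      by (auto simp: sin_zero_iff_int2)
    ultimately show "\<exists>\<zeta>. fractional_revival M (?\<alpha> \<zeta> \<gamma>) (?\<beta> \<zeta> \<gamma>) u v \<tau> \<and>
        (proper_fractional_revival M (?\<alpha> \<zeta> \<gamma>) (?\<beta> \<zeta> \<gamma>) u v \<tau> \<longleftrightarrow> (\<nexists>m :: int. \<gamma> = of_int m * pi))"
      unfolding proper_fractional_revival_def by blast
  qed
qed

end
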